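(* Let $G$ be a group with finite symmetric generating set $X$, hyperbolic relative to a collection of subgroups $\mathcal{H}=\{H_i\}_{i=1}^m$. Let $Q$ and $R$ be relatively quasiconvex subgroups of $G$. Then $Q\cap R$ is a relatively quasiconvex subgroup of $G$.
   Context: Setting. $G$ is a group, $X$ a finite generating set of $G$ closed under inverses, $\mathcal{H}=\{H_i\}_{i=1}^m$ a finite collection of subgroups. $|g|_X$ is the word length and $dist_X(f,g)=|f^{-1}g|_X$. Let $\widetilde{\mathcal{H}}=\bigsqcup_{i=1}^m(\widetilde{H_i}\setminus\{1\})$, where $\widetilde{H_i}$ is a copy of $H_i$, and let $\Gamma=Cayley(G,X\cup\widetilde{\mathcal{H}})$ be the graph with vertex set $G$ and, for each $g\in G$ and each letter $a\in X\sqcup\widetilde{\mathcal{H}}$, an edge from $g$ to $ga$ with label $a$; all edges have length 1. For a path $p$, $p_-$ and $p_+$ are its initial and terminal vertices and $l(p)$ its length. A path $p$ is a $(\lambda,c)$-quasi-geodesic if $l(q)\leq\lambda d(q_-,q_+)+c$ for every subpath $q$ of $p$, $d$ being the metric of $\Gamma$. Components. An $H_i$-component of a path $q$ in $\Gamma$ is a maximal subpath with at least one edge whose label is a word in the alphabet $\widetilde{H_i}\setminus\{1\}$; an $\mathcal{H}$-component is an $H_i$-component for some $i$. Two $\mathcal{H}$-components (of one path or of two paths) are connected if, for some $i$, both are $H_i$-components and their vertices belong to the same left coset of $H_i$. An $\mathcal{H}$-component of $q$ is isolated if it is not connected to a different $\mathcal{H}$-component of $q$. A path is without backtracking if all its $\mathcal{H}$-components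 are isolated. A vertex of $q$ is phase if it is not an inner vertex of an $\mathcal{H}$-component of $q$. Two paths $p,q$ are $k$-similar if $\max\{dist_X(p_-,q_-),dist_X(p_+,q_+)\}\leq k$. Bounded coset penetration (BCP). $(G,\mathcal{H})$ satisfies BCP if for all $\lambda\geq1$, $c\geq0$, $k\geq0$ there is an integer $\epsilon(\lambda,c,k)>0$ such that for any two $k$-similar $(\lambda,c)$-quasi-geodesics $p,q$ in $\Gamma$ without backtracking: (i) the sets of phase vertices of $p$ and $q$ are contained in the closed $\epsilon(\lambda,c,k)$-neighborhoods of each other with respect to $dist_X$; (ii) if $s$ is an $\mathcal{H}$-component of $p$ with $dist_X(s_-,s_+)>\epsilon(\lambda,c,k)$, then some $\mathcal{H}$-component of $q$ is connected to $s$; (iii) if $s,t$ are connected $\mathcal{H}$-components of $p,q$ respectively, then $\max\{dist_X(s_-,t_-),dist_X(s_+,t_+)\}\leq\epsilon(\lambda,c,k)$. $G$ is hyperbolic relative to $\mathcal{H}$ if $\Gamma$ is a $\delta$-hyperbolic metric space for some $\delta\ge 0$ and $(G,\mathcal{H})$ satisfies BCP. A subgroup $Q\leq G$ is relatively quasiconvex if there is $\sigma\geq0$ (and then $Q$ is called $\sigma$-quasiconvex) such that for all $f,g\in Q$, every geodesic $p$ in $\Gamma$ from $f$ to $g$ and every vertex $v$ of $p$, there is $w\in Q$ with $dist_X(v,w)\leq\sigma$. *)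

theory Defs
  imports "HOL-Algebra.Generated_Groups" "HOL-Analysis.Abstract_Metric_Spaces"
begin

section \<open>Hyperbolic metric spaces\<close>

definition geodesic_segment ::
    "'p set \<Rightarrow> ('p \<Rightarrow> 'p \<Rightarrow> real) \<Rightarrow> real \<Rightarrow> (real \<Rightarrow> 'p) \<Rightarrow> 'p \<Rightarrow> 'p \<Rightarrow> bool" where
  "geodesic_segment M d l \<gamma> x y \<longleftrightarrow>
     0 \<le> l \<and> \<gamma> ` {0..l} \<subseteq> M \<and> \<gamma> 0 = x \<and> \<gamma> l = y \<and>
     (\<forall>s\<in>{0..l}. \<forall>t\<in>{0..l}. d (\<gamma> s) (\<gamma> t) = \<bar>s - t\<bar>)"

text \<open>A geodesic metric space all of whose geodesic triangles are \<open>\<delta>\<close>-slim. Only the side from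
  \<open>x\<close> to \<open>y\<close> is mentioned, since the vertices range over all of \<open>M\<close>.\<close>

definition hyperbolic_space :: "real \<Rightarrow> 'p set \<Rightarrow> ('p \<Rightarrow> 'p \<Rightarrow> real) \<Rightarrow> bool" where
  "hyperbolic_space \<delta> M d \<longleftrightarrow>
     Metric_space M d \<and>
     (\<forall>x\<in>M. \<forall>y\<in>M. \<exists>l \<gamma>. geodesic_segment M d l \<gamma> x y) \<and>
     (\<forall>x\<in>M. \<forall>y\<in>M. \<forall>z\<in>M. \<forall>l1 l2 l3 \<gamma>1 \<gamma>2 \<gamma>3.
        geodesic_segment M d l1 \<gamma>1 x y \<longrightarrow>
        geodesic_segment M d l2 \<gamma>2 y z \<longrightarrow>
        geodesic_segment M d l3 \<gamma>3 x z \<longrightarrow>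
        (\<forall>u\<in>\<gamma>1 ` {0..l1}. \<exists>v\<in>\<gamma>2 ` {0..l2} \<union> \<gamma>3 ` {0..l3}. d u v \<le> \<delta>))"

section \<open>Letters, paths and points of the Cayley graph\<close>

text \<open>The disjoint union of \<open>X\<close> and of the copies of the \<open>H i\<close>: \<open>Gen x\<close> is the letter
  \<open>x \<in> X\<close>, and \<open>Per i h\<close> is the copy of \<open>h \<in> H i\<close>. Equal group elements may be distinct letters.\<close>

datatype 'a letter = Gen 'a | Per nat 'a

fun letter_val :: "'a letter \<Rightarrow> 'a" where
  "letter_val (Gen x) = x"
| "letter_val (Per i h) = h"

text \<open>A path is its initial vertex together with its label. As the alphabet is closed under
  inverses, running backwards along the edge with label \<open>a\<close> is running along the edge whose
  label is the inverse of \<open>a\<close>.\<close>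

type_synonym 'a path = "'a \<times> 'a letter list"

abbreviation path_length :: "'a path \<Rightarrow> nat" where
  "path_length p \<equiv> length (snd p)"

definition path_vertex :: "('a, 'b) monoid_scheme \<Rightarrow> 'a path \<Rightarrow> nat \<Rightarrow> 'a" where
  "path_vertex G p n = foldl (\<lambda>v a. v \<otimes>\<^bsub>G\<^esub> letter_val a) (fst p) (take n (snd p))"

abbreviation path_start :: "('a, 'b) monoid_scheme \<Rightarrow> 'a path \<Rightarrow> 'a" where
  "path_start G p \<equiv> path_vertex G p 0"

abbreviation path_end :: "('a, 'b) monoid_scheme \<Rightarrow> 'a path \<Rightarrow> 'a" where
  "path_end G p \<equiv> path_vertex G p (path_length p)"

definition subpath :: "('a, 'b) monoid_scheme \<Rightarrow> 'a path \<Rightarrow> nat \<Rightarrow> nat \<Rightarrow> 'a path" where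
  "subpath G p j k = (path_vertex G p j, take (k - j) (drop j (snd p)))"

text \<open>Points of the graph as a metric space: the vertices, and the inner points of the edges.
  \<open>Inner g a t\<close> with \<open>0 < t < 1\<close> is the point at distance \<open>t\<close> from \<open>g\<close> along the edge
  with label \<open>a\<close> that leaves \<open>g\<close>.\<close>

datatype 'a graph_point = Vertex 'a | Inner 'a "'a letter" real

text \<open>The vertices from which a point is reached within its own edge, with the distances covered.\<close>

fun feet :: "('a, 'b) monoid_scheme \<Rightarrow> 'a graph_point \<Rightarrow> ('a \<times> real) set" where
  "feet G (Vertex g) = {(g, 0)}"
| "feet G (Inner g a t) = {(g, t), (g \<otimes>\<^bsub>G\<^esub> letter_val a, 1 - t)}"

section \<open>Relative hyperbolicity and relative quasiconvexity\<close>

context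
  fixes G :: "('a, 'b) monoid_scheme" (structure)
    and X :: "'a set" and m :: nat and H :: "nat \<Rightarrow> 'a set"
begin

subsection \<open>Word metric\<close>

definition word_length :: "'a \<Rightarrow> nat" where
  "word_length g = (LEAST n. \<exists>w. length w = n \<and> set w \<subseteq> X \<and> foldr (\<otimes>) w \<one> = g)"

definition dist_X :: "'a \<Rightarrow> 'a \<Rightarrow> nat" where
  "dist_X f g = word_length (inv f \<otimes> g)"

subsection \<open>The Cayley graph\<close>

definition letters :: "'a letter set" where
  "letters = Gen ` X \<union> (\<Union>i\<in>{1..m}. Per i ` (H i - {\<one>}))"

definition is_path :: "'a path \<Rightarrow> bool" where
  "is_path p \<longleftrightarrow> fst p \<in> carrier G \<and> set (snd p) \<subseteq> letters"

definition graph_dist :: "'a \<Rightarrow> 'a \<Rightarrow> nat" where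
  "graph_dist f g =
     (LEAST n. \<exists>p. is_path p \<and> path_start G p = f \<and> path_end G p = g \<and> path_length p = n)"

definition is_geodesic :: "'a path \<Rightarrow> bool" where
  "is_geodesic p \<longleftrightarrow> is_path p \<and> path_length p = graph_dist (path_start G p) (path_end G p)"

definition quasi_geodesic :: "real \<Rightarrow> real \<Rightarrow> 'a path \<Rightarrow> bool" where
  "quasi_geodesic L c p \<longleftrightarrow> is_path p \<and>
     (\<forall>j k. j \<le> k \<and> k \<le> path_length p \<longrightarrow>
        (let q = subpath G p j k in
          real (path_length q) \<le> L * real (graph_dist (path_start G q) (path_end G q)) + c))"

definition graph_points :: "'a graph_point set" where
  "graph_points = Vertex ` carrier G \<union>
     {Inner g a t | g a t. g \<in> carrier G \<and> a \<in> letters \<and> 0 < t \<and> t < 1}"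

text \<open>The length metric of the graph with edges of length 1. A shortest route between two points
  passes through feet of both, unless it stays inside one edge. The locale \<open>Metric_space\<close>
  asks for nonnegativity and symmetry on the whole type, whence the value 0 outside the graph.\<close>

definition route_dist :: "'a graph_point \<Rightarrow> 'a graph_point \<Rightarrow> real" where
  "route_dist x y =
     Min {s + real (graph_dist u v) + t | u s v t. (u, s) \<in> feet G x \<and> (v, t) \<in> feet G y}"

definition point_dist :: "'a graph_point \<Rightarrow> 'a graph_point \<Rightarrow> real" where
  "point_dist x y =
     (if x \<in> graph_points \<and> y \<in> graph_points then
        (case (x, y) of
           (Inner g a s, Inner h b t) \<Rightarrow>
             if g = h \<and> a = b then min \<bar>s - t\<bar> (route_dist x y) else route_dist x y
         | _ \<Rightarrow> route_dist x y)
      else 0)"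

subsection \<open>Components\<close>

text \<open>Components, and vertices of a path that are to be told apart, are given by their positions:
  \<open>(j, k)\<close> stands for the subpath from the \<open>j\<close>-th to the \<open>k\<close>-th vertex.\<close>

definition labelled_in :: "nat \<Rightarrow> 'a path \<Rightarrow> nat \<Rightarrow> nat \<Rightarrow> bool" where
  "labelled_in i p j k \<longleftrightarrow> set (snd (subpath G p j k)) \<subseteq> Per i ` (H i - {\<one>})"

definition is_component :: "nat \<Rightarrow> 'a path \<Rightarrow> nat \<times> nat \<Rightarrow> bool" where
  "is_component i p = (\<lambda>(j, k). i \<in> {1..m} \<and> j < k \<and> k \<le> path_length p \<and> labelled_in i p j k \<and>
     (\<forall>j' k'. j' \<le> j \<and> k \<le> k' \<and> k' \<le> path_length p \<and> labelled_in i p j' k' \<longrightarrow>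
        j' = j \<and> k' = k))"

definition is_H_component :: "'a path \<Rightarrow> nat \<times> nat \<Rightarrow> bool" where
  "is_H_component p s \<longleftrightarrow> (\<exists>i\<in>{1..m}. is_component i p s)"

definition connected_components ::
    "'a path \<Rightarrow> nat \<times> nat \<Rightarrow> 'a path \<Rightarrow> nat \<times> nat \<Rightarrow> bool" where
  "connected_components p s q t \<longleftrightarrow>
     (\<exists>i\<in>{1..m}. is_component i p s \<and> is_component i q t \<and>
       (\<exists>g\<in>carrier G. path_vertex G p ` {fst s..snd s} \<union> path_vertex G q ` {fst t..snd t}
          \<subseteq> g <# H i))"

definition isolated :: "'a path \<Rightarrow> nat \<times> nat \<Rightarrow> bool" where
  "isolated p s \<longleftrightarrow> (\<forall>t. is_H_component p t \<and> t \<noteq> s \<longrightarrow> \<not> connected_components p s p t)"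

definition without_backtracking :: "'a path \<Rightarrow> bool" where
  "without_backtracking p \<longleftrightarrow> (\<forall>s. is_H_component p s \<longrightarrow> isolated p s)"

definition phase_vertices :: "'a path \<Rightarrow> 'a set" where
  "phase_vertices p = path_vertex G p `
     {n. n \<le> path_length p \<and> \<not> (\<exists>j k. is_H_component p (j, k) \<and> j < n \<and> n < k)}"

definition similar_paths :: "real \<Rightarrow> 'a path \<Rightarrow> 'a path \<Rightarrow> bool" where
  "similar_paths k p q \<longleftrightarrow>
     real (max (dist_X (path_start G p) (path_start G q))
               (dist_X (path_end G p) (path_end G q))) \<le> k"

subsection \<open>Main notions\<close>

definition BCP :: bool where
  "BCP \<longleftrightarrow> (\<forall>L\<ge>1. \<forall>c\<ge>0. \<forall>k\<ge>0. \<exists>\<epsilon>::nat. \<epsilon> > 0 \<and>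
     (\<forall>p q. quasi_geodesic L c p \<and> quasi_geodesic L c q \<and> similar_paths k p q \<and>
        without_backtracking p \<and> without_backtracking q \<longrightarrow>
        (\<forall>u\<in>phase_vertices p. \<exists>v\<in>phase_vertices q. dist_X u v \<le> \<epsilon>) \<and>
        (\<forall>v\<in>phase_vertices q. \<exists>u\<in>phase_vertices p. dist_X v u \<le> \<epsilon>) \<and>
        (\<forall>s. is_H_component p s \<and>
             dist_X (path_vertex G p (fst s)) (path_vertex G p (snd s)) > \<epsilon> \<longrightarrow>
             (\<exists>t. is_H_component q t \<and> connected_components p s q t)) \<and>
        (\<forall>s t. is_H_component p s \<and> is_H_component q t \<and> connected_components p s q t \<longrightarrow>
             max (dist_X (path_vertex G p (fst s)) (path_vertex G q (fst t)))
                 (dist_X (path_vertex G p (snd s)) (path_vertex G q (snd t))) \<le> \<epsilon>)))"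

definition relatively_hyperbolic :: bool where
  "relatively_hyperbolic \<longleftrightarrow> (\<exists>\<delta>\<ge>0. hyperbolic_space \<delta> graph_points point_dist) \<and> BCP"

definition quasiconvex :: "real \<Rightarrow> 'a set \<Rightarrow> bool" where
  "quasiconvex \<sigma> Q \<longleftrightarrow>
     (\<forall>f\<in>Q. \<forall>g\<in>Q. \<forall>p. is_geodesic p \<and> path_start G p = f \<and> path_end G p = g \<longrightarrow>
        (\<forall>v\<in>path_vertex G p ` {0..path_length p}. \<exists>w\<in>Q. real (dist_X v w) \<le> \<sigma>))"

definition relatively_quasiconvex :: "'a set \<Rightarrow> bool" where
  "relatively_quasiconvex Q \<longleftrightarrow> subgroup Q G \<and> (\<exists>\<sigma>\<ge>0. quasiconvex \<sigma> Q)"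

end

end

theory Submission
  imports Defs
begin

text \<open>A vertex \<open>v\<close> of a geodesic with endpoints in \<open>Q \<inter> R\<close> is \<open>dist_X\<close>-close to some \<open>q \<in> Q\<close> and
  to some \<open>r \<in> R\<close>, so it suffices that points close to both subgroups are close to their
  intersection. That is a pigeonhole argument on the pair \<open>(v\<inverse>q, v\<inverse>r)\<close>, which ranges over a
  finite set because \<open>X\<close> is finite. If \<open>v\<^sub>0, q\<^sub>0, r\<^sub>0\<close> give the same pair, then
  \<open>v v\<^sub>0\<inverse> = q q\<^sub>0\<inverse> = r r\<^sub>0\<inverse>\<close> belongs to \<open>Q \<inter> R\<close>, and its distance to \<open>v\<close> is the length of
  \<open>v\<^sub>0\<inverse>\<close>. One \<open>v\<^sub>0\<close> for each pair therefore bounds the distance from \<open>v\<close> to \<open>Q \<inter> R\<close>, uniformly in \<open>v\<close>.\<close>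

lemma (in group) foldr_mult_append:
  assumes "set u \<subseteq> carrier G" and "set w \<subseteq> carrier G"
  shows "foldr (\<otimes>) (u @ w) \<one> = foldr (\<otimes>) u \<one> \<otimes> foldr (\<otimes>) w \<one>"
proof -
  have closed: "foldr (\<otimes>) t \<one> \<in> carrier G" if "set t \<subseteq> carrier G" for t
    using that by (induction t) auto
  show ?thesis
    using assms(1) by (induction u) (auto simp: closed assms(2) m_assoc)
qed

text \<open>Closure under inverses is what makes positive words in \<open>X\<close> suffice.\<close>

lemma (in group) generate_obtain_word:
  assumes "X \<subseteq> carrier G" and "\<forall>x\<in>X. inv x \<in> X" and "g \<in> generate G X"
  shows "\<exists>w. set w \<subseteq> X \<and> foldr (\<otimes>) w \<one> = g"
  using assms(3)
proof (induction rule: generate.induct)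
  case one
  show ?case by (rule exI[of _ "[]"]) simp
next
  case (incl x)
  then show ?case using assms(1) by (intro exI[of _ "[x]"]) auto
next
  case (inv x)
  then show ?case using assms(1,2) by (intro exI[of _ "[inv x]"]) auto
next
  case (eng g h)
  then obtain u w where "set u \<subseteq> X" "foldr (\<otimes>) u \<one> = g" "set w \<subseteq> X" "foldr (\<otimes>) w \<one> = h"
    by blast
  then show ?case
    using assms(1) by (intro exI[of _ "u @ w"]) (simp add: foldr_mult_append del: foldr_append)
qed

lemma (in group) finite_word_length_ball:
  assumes "finite X" and "X \<subseteq> carrier G" and "\<forall>x\<in>X. inv x \<in> X" and "generate G X = carrier G"
  shows "finite {g \<in> carrier G. real (word_length G X g) \<le> \<sigma>}"
proof (rule finite_subset)
  show "finite ((\<lambda>w. foldr (\<otimes>) w \<one>) ` {w. set w \<subseteq> X \<and> length w \<le> nat \<lfloor>\<sigma>\<rfloor>})"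
    using assms(1) by (simp add: finite_lists_length_le)
  show "{g \<in> carrier G. real (word_length G X g) \<le> \<sigma>}
    \<subseteq> (\<lambda>w. foldr (\<otimes>) w \<one>) ` {w. set w \<subseteq> X \<and> length w \<le> nat \<lfloor>\<sigma>\<rfloor>}"
  proof clarify
    fix g assume g: "g \<in> carrier G" and le: "real (word_length G X g) \<le> \<sigma>"
    have "\<exists>n w. length w = n \<and> set w \<subseteq> X \<and> foldr (\<otimes>) w \<one> = g"
      using generate_obtain_word[OF assms(2,3)] g assms(4) by blast
    then have "\<exists>w. length w = word_length G X g \<and> set w \<subseteq> X \<and> foldr (\<otimes>) w \<one> = g"
      unfolding word_length_def by (rule LeastI_ex)
    then obtain w where "length w = word_length G X g" "set w \<subseteq> X" "foldr (\<otimes>) w \<one> = g"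
      by blast
    then show "g \<in> (\<lambda>w. foldr (\<otimes>) w \<one>) ` {w. set w \<subseteq> X \<and> length w \<le> nat \<lfloor>\<sigma>\<rfloor>}"
      using le by (intro image_eqI[of _ _ w]) (auto intro: le_nat_floor)
  qed
qed

text \<open>Left translation by \<open>v v\<^sub>0\<inverse>\<close> carries one configuration \<open>(v\<^sub>0, q\<^sub>0, r\<^sub>0)\<close> with differences
  \<open>(a, b)\<close> to any other one \<open>(v, q, r)\<close>, so this element lies in both subgroups. The bound depends
  on the chosen \<open>v\<^sub>0\<close> and not on \<open>v\<close>.\<close>

lemma (in group) dist_X_inter_of_fixed_differences:
  assumes Q: "subgroup Q G" and R: "subgroup R G"
  shows "\<exists>B. \<forall>v\<in>carrier G. (\<exists>q\<in>Q. inv v \<otimes> q = a) \<and> (\<exists>r\<in>R. inv v \<otimes> r = b) \<longrightarrow>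
    (\<exists>w\<in>Q \<inter> R. dist_X G X v w \<le> B)"
proof (cases "\<exists>v\<in>carrier G. (\<exists>q\<in>Q. inv v \<otimes> q = a) \<and> (\<exists>r\<in>R. inv v \<otimes> r = b)")
  case False
  then show ?thesis by blast
next
  case True
  then obtain v0 q0 r0 where v0: "v0 \<in> carrier G"
    and q0: "q0 \<in> Q" "inv v0 \<otimes> q0 = a" and r0: "r0 \<in> R" "inv v0 \<otimes> r0 = b"
    by blast
  have translate: "v \<otimes> inv v0 \<in> S"
    if "subgroup S G" "v \<in> carrier G" "s \<in> S" "s0 \<in> S" "inv v \<otimes> s = inv v0 \<otimes> s0" for S v s s0
  proof -
    have s: "s \<in> carrier G" "s0 \<in> carrier G"
      using that(1,3,4) by (auto dest: subgroup.mem_carrier)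
    have "s = v \<otimes> (inv v \<otimes> s)"
      using s that(2) by (simp add: m_assoc[symmetric])
    also have "\<dots> = v \<otimes> inv v0 \<otimes> s0"
      using s that(2) v0 by (simp add: that(5) m_assoc)
    finally have "v \<otimes> inv v0 = s \<otimes> inv s0"
      using s that(2) v0 by (simp add: m_assoc)
    then show ?thesis
      using that by (simp add: subgroup.m_closed subgroup.m_inv_closed)
  qed
  show ?thesis
  proof (intro exI[of _ "word_length G X (inv v0)"] ballI impI)
    fix v assume v: "v \<in> carrier G" and "(\<exists>q\<in>Q. inv v \<otimes> q = a) \<and> (\<exists>r\<in>R. inv v \<otimes> r = b)"
    then have "v \<otimes> inv v0 \<in> Q \<inter> R"
      using translate[OF Q v _ q0(1)] translate[OF R v _ r0(1)] q0(2) r0(2) by auto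
    moreover have "inv v \<otimes> (v \<otimes> inv v0) = inv v0"
      using v v0 by (simp add: m_assoc[symmetric])
    ultimately show "\<exists>w\<in>Q \<inter> R. dist_X G X v w \<le> word_length G X (inv v0)"
      by (intro bexI[of _ "v \<otimes> inv v0"]) (simp_all add: dist_X_def)
  qed
qed

lemma (in group) neighborhoods_inter_subset_neighborhood_inter:
  assumes "finite X" and "X \<subseteq> carrier G" and "\<forall>x\<in>X. inv x \<in> X" and "generate G X = carrier G"
    and Q: "subgroup Q G" and R: "subgroup R G"
  shows "\<exists>B. \<forall>v\<in>carrier G. (\<exists>q\<in>Q. real (dist_X G X v q) \<le> \<sigma>) \<and>
    (\<exists>r\<in>R. real (dist_X G X v r) \<le> \<tau>) \<longrightarrow> (\<exists>w\<in>Q \<inter> R. dist_X G X v w \<le> B)"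
proof -
  obtain B where B: "\<And>a b v. \<lbrakk>v \<in> carrier G; \<exists>q\<in>Q. inv v \<otimes> q = a; \<exists>r\<in>R. inv v \<otimes> r = b\<rbrakk> \<Longrightarrow>
      \<exists>w\<in>Q \<inter> R. dist_X G X v w \<le> B (a, b)"
    using dist_X_inter_of_fixed_differences[OF Q R, of "fst c" "snd c" X for c]
      choice[of "\<lambda>c B. \<forall>v\<in>carrier G. (\<exists>q\<in>Q. inv v \<otimes> q = fst c) \<and> (\<exists>r\<in>R. inv v \<otimes> r = snd c) \<longrightarrow>
        (\<exists>w\<in>Q \<inter> R. dist_X G X v w \<le> B)"]
    by (metis fst_conv snd_conv)
  let ?ball = "\<lambda>\<rho>. {g \<in> carrier G. real (word_length G X g) \<le> \<rho>}"
  let ?P = "?ball \<sigma> \<times> ?ball \<tau>"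
  have fin: "finite ?P"
    using finite_word_length_ball[OF assms(1-4)] by blast
  show ?thesis
  proof (intro exI[of _ "Max (B ` ?P)"] ballI impI)
    fix v assume v: "v \<in> carrier G" and "(\<exists>q\<in>Q. real (dist_X G X v q) \<le> \<sigma>) \<and>
      (\<exists>r\<in>R. real (dist_X G X v r) \<le> \<tau>)"
    then obtain q r where q: "q \<in> Q" "real (dist_X G X v q) \<le> \<sigma>"
      and r: "r \<in> R" "real (dist_X G X v r) \<le> \<tau>" by blast
    then have "(inv v \<otimes> q, inv v \<otimes> r) \<in> ?P"
      using v Q R by (auto simp: dist_X_def dest: subgroup.mem_carrier)
    then have "B (inv v \<otimes> q, inv v \<otimes> r) \<le> Max (B ` ?P)"
      using fin by (intro Max_ge finite_imageI imageI)
    moreover obtain w where "w \<in> Q \<inter> R" "dist_X G X v w \<le> B (inv v \<otimes> q, inv v \<otimes> r)"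
      using B[OF v] q(1) r(1) by blast
    ultimately show "\<exists>w\<in>Q \<inter> R. dist_X G X v w \<le> Max (B ` ?P)"
      by (meson order_trans)
  qed
qed

lemma (in group) path_vertex_carrier:
  assumes "X \<subseteq> carrier G" and "\<forall>i\<in>{1..m}. subgroup (H i) G" and "is_path G X m H p"
  shows "path_vertex G p n \<in> carrier G"
proof -
  have "H i \<subseteq> carrier G" if "i \<in> {1..m}" for i
    using that assms(2) subgroup.subset by blast
  then have "letter_val a \<in> carrier G" if "a \<in> letters G X m H" for a
    using that assms(1) unfolding letters_def by fastforce
  then have "letter_val ` set (take n (snd p)) \<subseteq> carrier G"
    using assms(3) by (auto simp: is_path_def dest: in_set_takeD)
  moreover have "foldl (\<lambda>v a. v \<otimes> letter_val a) g as \<in> carrier G"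
    if "g \<in> carrier G" "letter_val ` set as \<subseteq> carrier G" for g as
    using that by (induction as arbitrary: g) auto
  ultimately show ?thesis
    using assms(3) by (simp add: path_vertex_def is_path_def)
qed

theorem proposition1p3:
  fixes G :: "('a, 'b) monoid_scheme" and X :: "'a set"
    and m :: nat and H :: "nat \<Rightarrow> 'a set" and Q R :: "'a set"
  assumes "group G"
    and "finite X" and "X \<subseteq> carrier G" and "\<forall>x\<in>X. inv\<^bsub>G\<^esub> x \<in> X"
    and "generate G X = carrier G"
    and "\<forall>i\<in>{1..m}. subgroup (H i) G"
    and "relatively_hyperbolic G X m H"
    and "relatively_quasiconvex G X m H Q"
    and "relatively_quasiconvex G X m H R"
  shows "relatively_quasiconvex G X m H (Q \<inter> R)"
proof -
  interpret group G by fact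
  obtain \<sigma> \<tau> where Q: "subgroup Q G" "quasiconvex G X m H \<sigma> Q"
    and R: "subgroup R G" "quasiconvex G X m H \<tau> R"
    using assms(8,9) unfolding relatively_quasiconvex_def by blast
  obtain B where B: "\<forall>v\<in>carrier G. (\<exists>q\<in>Q. real (dist_X G X v q) \<le> \<sigma>) \<and>
      (\<exists>r\<in>R. real (dist_X G X v r) \<le> \<tau>) \<longrightarrow> (\<exists>w\<in>Q \<inter> R. dist_X G X v w \<le> B)"
    using neighborhoods_inter_subset_neighborhood_inter[OF assms(2-5) Q(1) R(1)] by blast
  have "quasiconvex G X m H (real B) (Q \<inter> R)"
    unfolding quasiconvex_def
  proof (intro ballI allI impI)
    fix f g p v
    assume f: "f \<in> Q \<inter> R" and g: "g \<in> Q \<inter> R"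
      and p: "is_geodesic G X m H p \<and> path_start G p = f \<and> path_end G p = g"
      and v: "v \<in> path_vertex G p ` {0..path_length p}"
    have "\<exists>q\<in>Q. real (dist_X G X v q) \<le> \<sigma>"
      using Q(2) f g p v unfolding quasiconvex_def by blast
    moreover have "\<exists>r\<in>R. real (dist_X G X v r) \<le> \<tau>"
      using R(2) f g p v unfolding quasiconvex_def by blast
    moreover have "v \<in> carrier G"
      using path_vertex_carrier[OF assms(3,6)] p v unfolding is_geodesic_def by blast
    ultimately show "\<exists>w\<in>Q \<inter> R. real (dist_X G X v w) \<le> real B"
      using B by simp
  qed
  then show ?thesis
    unfolding relatively_quasiconvex_def
    using subgroups_Inter_pair[OF Q(1) R(1)] by (intro conjI exI[of _ "real B"]) auto
qed

end
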